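(* Let $p$ be an odd prime and write $\frac{p+1}{8}=\frac mn$ in lowest terms. For all nonnegative integers $i,h$ and all $\tau$ in the upper half plane, with $q=e^{i\pi\tau}$, $$X^iY^h=2^{ni}q^{mi}\sum_{l=0}^{\infty}b_l(i+2h,\,i)\,q^l.$$
   Context: For an odd prime $p$, $m,n$ are the coprime positive integers with $\frac{p+1}{8}=\frac mn$ (so $n\in\{1,2,4\}$). For $\tau$ in the upper half plane put $q=e^{i\pi\tau}$ and $Q(\tau)=\prod_{k\ge1}(1-q^k)$. The modular lambda function is $\lambda(\tau)=\theta_2^4(\tau)/\theta_3^4(\tau)$; one has $\lambda(\tau)=16q\,\frac{Q^8(\tau)Q^{16}(4\tau)}{Q^{24}(2\tau)}$ and $1-\lambda(\tau)=\frac{Q^{16}(\tau)Q^{8}(4\tau)}{Q^{24}(2\tau)}$. Put $$X=(\lambda(\tau)\lambda(p\tau))^{n/8},\qquad Y=((1-\lambda(\tau))(1-\lambda(p\tau)))^{n/8},$$ with roots taken through the product formulas, i.e. $$X=2^nq^m\frac{Q^n(\tau)Q^{2n}(4\tau)}{Q^{3n}(2\tau)}\cdot\frac{Q^n(p\tau)Q^{2n}(4p\tau)}{Q^{3n}(2p\tau)},\qquad Y=\frac{Q^{2n}(\tau)Q^{n}(4\tau)}{Q^{3n}(2\tau)}\cdot\frac{Q^{2n}(p\tau)Q^{n}(4p\tau)}{Q^{3n}(2p\tau)}.$$ With the convention that $\sigma_1(x)/x$ is replaced by $0$ when $x$ is not a positive integer ($\sigma_1$ is the sum-of-divisors function), $$\alpha_p(k)=\frac{\sigma_1(k)}{k}-3\frac{\sigma_1(k/2)}{k/2}+2\frac{\sigma_1(k/4)}{k/4}+\frac{\sigma_1(k/p)}{k/p}-3\frac{\sigma_1(k/2p)}{k/2p}+2\frac{\sigma_1(k/4p)}{k/4p}.$$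 Partitions: for a finitely supported sequence $J=[j_1,j_2,\dots]$ of nonnegative integers let $w(J)=\sum_k kj_k$, $|J|=\sum_k j_k$, $J_o=\sum_{k\text{ odd}}j_k$, $J_e=\sum_{k\text{ even}}j_k$, $W_p(J)=\prod_{k\ge1}\frac{\alpha_p(k)^{j_k}}{j_k!}$, and let $J[l]$ be the set of all $J$ with $w(J)=l$. Define (with $0^0=1$) $$b_0(u,v)=1,\qquad b_l(u,v)=\sum_{J\in J[l]}(-n)^{|J|}u^{J_o}v^{J_e}W_p(J)\quad(l\ge1).$$ *)

theory Defs
  imports "HOL-Analysis.Analysis" "HOL-Computational_Algebra.Primes"
begin

definition nome :: "complex \<Rightarrow> complex" where
  "nome \<tau> = exp (\<i> * of_real pi * \<tau>)"

definition Q :: "complex \<Rightarrow> complex" where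
  "Q \<tau> = (\<Prod>k. 1 - nome \<tau> ^ Suc k)"

text \<open>
  With the modular function \<open>\<lambda>(\<tau>) = \<theta>\<^sub>2(\<tau>)^4 / \<theta>\<^sub>3(\<tau>)^4\<close>, \<open>XX\<close> and \<open>YY\<close> are
  \<open>(\<lambda>(\<tau>) \<lambda>(p\<tau>))\<close> and \<open>((1 - \<lambda>(\<tau>)) (1 - \<lambda>(p\<tau>)))\<close> raised to the power \<open>n/8\<close>,
  where \<open>(p + 1)/8 = m/n\<close>. The branch of the root is the one given by the products
  \<open>\<lambda>(\<tau>) = 16 q Q(\<tau>)^8 Q(4\<tau>)^16 / Q(2\<tau>)^24\<close> and
  \<open>1 - \<lambda>(\<tau>) = Q(\<tau>)^16 Q(4\<tau>)^8 / Q(2\<tau>)^24\<close>.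
\<close>

definition XX :: "nat \<Rightarrow> nat \<Rightarrow> nat \<Rightarrow> complex \<Rightarrow> complex" where
  "XX p m n \<tau> = 2 ^ n * nome \<tau> ^ m
     * (Q \<tau> ^ n * Q (4 * \<tau>) ^ (2 * n) / Q (2 * \<tau>) ^ (3 * n))
     * (Q (of_nat p * \<tau>) ^ n * Q (4 * of_nat p * \<tau>) ^ (2 * n) / Q (2 * of_nat p * \<tau>) ^ (3 * n))"

definition YY :: "nat \<Rightarrow> nat \<Rightarrow> complex \<Rightarrow> complex" where
  "YY p n \<tau> =
     (Q \<tau> ^ (2 * n) * Q (4 * \<tau>) ^ n / Q (2 * \<tau>) ^ (3 * n))
     * (Q (of_nat p * \<tau>) ^ (2 * n) * Q (4 * of_nat p * \<tau>) ^ n / Q (2 * of_nat p * \<tau>) ^ (3 * n))"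

definition sigma1 :: "nat \<Rightarrow> nat" where
  "sigma1 k = \<Sum>{d. d dvd k}"

definition sigma1_over :: "real \<Rightarrow> real" where
  "sigma1_over x = (if x \<in> \<nat> \<and> x > 0 then real (sigma1 (nat \<lfloor>x\<rfloor>)) / x else 0)"

definition alpha :: "nat \<Rightarrow> nat \<Rightarrow> real" where
  "alpha p k =
     sigma1_over (real k) - 3 * sigma1_over (real k / 2) + 2 * sigma1_over (real k / 4)
     + sigma1_over (real k / real p) - 3 * sigma1_over (real k / (2 * real p))
     + 2 * sigma1_over (real k / (4 * real p))"

text \<open>
  A sequence \<open>[j\<^sub>1, j\<^sub>2, \<dots>]\<close> is a function \<open>J :: nat \<Rightarrow> nat\<close> with \<open>J k = j\<^sub>k\<close> for \<open>k \<ge> 1\<close>;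
  the index \<open>0\<close>, which is not part of the sequence, is pinned to \<open>J 0 = 0\<close> so that each sequence
  has exactly one representative. Sums and products over all \<open>k\<close> are taken over the support:
  the omitted terms are \<open>0\<close> and the omitted factors \<open>a^0 / 0!\<close> are \<open>1\<close>.
\<close>

definition supp :: "(nat \<Rightarrow> nat) \<Rightarrow> nat set" where
  "supp J = {k. J k \<noteq> 0}"

definition weight :: "(nat \<Rightarrow> nat) \<Rightarrow> nat" where
  "weight J = (\<Sum>k\<in>supp J. k * J k)"

definition size_part :: "(nat \<Rightarrow> nat) \<Rightarrow> nat" where
  "size_part J = (\<Sum>k\<in>supp J. J k)"

definition odd_part :: "(nat \<Rightarrow> nat) \<Rightarrow> nat" where
  "odd_part J = (\<Sum>k\<in>{k \<in> supp J. odd k}. J k)"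

definition even_part :: "(nat \<Rightarrow> nat) \<Rightarrow> nat" where
  "even_part J = (\<Sum>k\<in>{k \<in> supp J. even k}. J k)"

definition Wp :: "nat \<Rightarrow> (nat \<Rightarrow> nat) \<Rightarrow> real" where
  "Wp p J = (\<Prod>k\<in>supp J. alpha p k ^ J k / fact (J k))"

definition partitions_of :: "nat \<Rightarrow> (nat \<Rightarrow> nat) set" where
  "partitions_of l = {J. J 0 = 0 \<and> finite (supp J) \<and> weight J = l}"

definition b :: "nat \<Rightarrow> nat \<Rightarrow> nat \<Rightarrow> real \<Rightarrow> real \<Rightarrow> real" where
  "b p n l u v =
     (if l = 0 then 1
      else \<Sum>J\<in>partitions_of l.
             (- real n) ^ size_part J * u ^ odd_part J * v ^ even_part J * Wp p J)"

text \<open>Each \<open>partitions_of l\<close> is finite, so the sum defining \<open>b\<close> is a genuine finite sum.\<close>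

lemma finite_partitions_of: "finite (partitions_of l)"
proof (rule finite_subset)
  show "partitions_of l \<subseteq> {J. \<forall>k. (k \<in> {1..l} \<longrightarrow> J k \<in> {0..l}) \<and> (k \<notin> {1..l} \<longrightarrow> J k = 0)}"
  proof (rule subsetI, rule CollectI, rule allI)
    fix J k assume J: "J \<in> partitions_of l"
    have le: "k * J k \<le> l" if "J k \<noteq> 0"
    proof -
      have "k * J k \<le> (\<Sum>k\<in>supp J. k * J k)"
        using J that by (intro member_le_sum) (auto simp: partitions_of_def supp_def)
      then show ?thesis using J by (simp add: partitions_of_def weight_def)
    qed
    have pos: "0 < k" if "J k \<noteq> 0"
      using J that by (cases k) (auto simp: partitions_of_def)
    have "k \<le> l \<and> J k \<le> l" if "J k \<noteq> 0"
    proof -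
      have "k \<le> k * J k" "J k \<le> k * J k"
        using pos[OF that] that by auto
      then show ?thesis using le[OF that] by linarith
    qed
    then show "(k \<in> {1..l} \<longrightarrow> J k \<in> {0..l}) \<and> (k \<notin> {1..l} \<longrightarrow> J k = 0)"
      using pos by (cases "J k = 0") auto
  qed
  show "finite {J :: nat \<Rightarrow> nat. \<forall>k. (k \<in> {1..l} \<longrightarrow> J k \<in> {0..l}) \<and> (k \<notin> {1..l} \<longrightarrow> J k = 0)}"
    by (rule finite_set_of_finite_funs) simp_all
qed

end

theory Submission
  imports Defs "HOL-Complex_Analysis.Complex_Analysis"
begin

text \<open>
  Take logarithms. Expanding \<open>Ln (1 - q\<^sup>d)\<close> in Euler's product gives
  \<open>Q \<tau> = exp (- (\<Sum>k\<ge>1. sigma1 k / k * q\<^sup>k))\<close> (lemmas \<open>log_double_series_sums\<close>, \<open>Q_eq_exp\<close>), and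
  replacing \<open>\<tau>\<close> by \<open>c * \<tau>\<close> replaces \<open>q\<close> by \<open>q\<^sup>c\<close>, that is, \<open>k\<close> by \<open>k / c\<close> in the coefficient. So, up
  to the factor \<open>2^(n * i) * q^(m * i)\<close>, the product \<open>X\<^sup>i * Y\<^sup>h\<close> is the exponential of a power series,
  whose coefficients combine divisor sums at \<open>k\<close>, \<open>k / 2\<close>, \<open>k / 4\<close> and at \<open>k / p\<close>, \<open>k / (2 * p)\<close>,
  \<open>k / (4 * p)\<close>. A priori \<open>X\<close> and \<open>Y\<close> lead to different combinations. The relation
  \<open>\<sigma>(2 * j) - 3 * \<sigma>(j) + 2 * \<sigma>(j / 2) = 0\<close> (\<open>sigma1_even_relation\<close>) merges them: the coefficient of
  \<open>q\<^sup>k\<close> is \<open>- n * (i + 2 * h) * alpha p k\<close> for odd \<open>k\<close> and \<open>- n * i * alpha p k\<close> for even \<open>k\<close>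
  (\<open>b_exponent_sums\<close>).

  It remains to exponentiate. The coefficient of \<open>q\<^sup>l\<close> in \<open>exp (\<Sum>k\<ge>1. c k * q\<^sup>k)\<close> is the sum over the
  partitions \<open>J\<close> of \<open>l\<close> of the products of \<open>c k ^ J k / J k!\<close> (\<open>exp_power_series_sums\<close>), and for the
  \<open>c k\<close> just found this sum is \<open>b p n l (i + 2 * h) i\<close> (\<open>b_eq_exp_coeff\<close>). The formula for the
  exponential comes from a differential equation: removing one part from a partition
  yields a recurrence for the partition sums which says that their generating series \<open>E\<close> satisfies
  \<open>E' = C' * E\<close> with \<open>C = (\<Sum>k\<ge>1. c k * q\<^sup>k)\<close>, and that equation together with \<open>E(0) = 1\<close> determines
  the Taylor series of \<open>exp \<circ> C\<close>, which converges in the whole disc where \<open>C\<close> is holomorphic.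
\<close>

section \<open>Coefficients of the exponential of a power series\<close>

text \<open>
  The coefficient of \<open>x\<^sup>l\<close> in \<open>exp (\<Sum>k\<ge>1. c k * x\<^sup>k) = (\<Prod>k\<ge>1. \<Sum>j. (c k * x\<^sup>k)\<^sup>j / j!)\<close>,
  read off by multiplying out the product formally.
\<close>

definition exp_coeff :: "(nat \<Rightarrow> complex) \<Rightarrow> nat \<Rightarrow> complex" where
  "exp_coeff c l = (\<Sum>J\<in>partitions_of l. \<Prod>k\<in>supp J. c k ^ J k / fact (J k))"

text \<open>
  Fixing one index set \<open>{1..N}\<close> for all the partitions in play lets the multiplicities be changed
  one at a time without the range of summation moving along with the support.
\<close>

lemma partitions_of_iff:
  assumes "l \<le> N"
  shows "J \<in> partitions_of l \<longleftrightarrow> supp J \<subseteq> {1..N} \<and> (\<Sum>k\<in>{1..N}. k * J k) = l"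
proof -
  have eq: "weight J = (\<Sum>k\<in>{1..N}. k * J k)" if "supp J \<subseteq> {1..N}"
    unfolding weight_def using that by (intro sum.mono_neutral_left) (auto simp: supp_def)
  show ?thesis
  proof
    assume J: "J \<in> partitions_of l"
    have sub: "supp J \<subseteq> {1..N}"
    proof
      fix k assume k: "k \<in> supp J"
      then have pos: "0 < k" "0 < J k"
        using J by (auto simp: partitions_of_def supp_def intro: gr0I)
      have "k * J k \<le> weight J"
        using J k unfolding weight_def by (intro member_le_sum) (auto simp: partitions_of_def)
      moreover have "k \<le> k * J k" using pos by simp
      moreover have "weight J \<le> N" using J assms by (simp add: partitions_of_def)
      ultimately have "k \<le> N" by linarith
      then show "k \<in> {1..N}" using pos by simp
    qed
    moreover have "(\<Sum>k\<in>{1..N}. k * J k) = l"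
      using J unfolding eq[OF sub, symmetric] by (simp add: partitions_of_def)
    ultimately show "supp J \<subseteq> {1..N} \<and> (\<Sum>k\<in>{1..N}. k * J k) = l" by (rule conjI)
  next
    assume J: "supp J \<subseteq> {1..N} \<and> (\<Sum>k\<in>{1..N}. k * J k) = l"
    then have "weight J = l" using eq by simp
    moreover have "finite (supp J)" using J by (blast intro: finite_subset finite_atLeastAtMost)
    moreover have "J 0 = 0" using J by (auto simp: supp_def)
    ultimately show "J \<in> partitions_of l" by (simp add: partitions_of_def)
  qed
qed

lemma prod_supp_extend:
  assumes "supp J \<subseteq> {1..N}"
  shows "(\<Prod>k\<in>supp J. c k ^ J k / fact (J k)) = (\<Prod>k\<in>{1..N}. c k ^ J k / fact (J k) :: complex)"
  using assms by (intro prod.mono_neutral_left) (auto simp: supp_def)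

text \<open>
  Adding one part \<open>k\<close> is a bijection from the partitions of \<open>l - k\<close> onto those partitions of \<open>l\<close>
  that have a part \<open>k\<close>. It multiplies the weight by \<open>c k / (J k + 1)\<close>, and the denominator is
  cancelled by the new multiplicity; partitions without a part \<open>k\<close> contribute \<open>0\<close> on the left.
\<close>

lemma sum_partitions_multiplicity:
  assumes "1 \<le> k" "k \<le> l"
  shows "(\<Sum>J\<in>partitions_of l. of_nat (J k) * (\<Prod>i\<in>supp J. c i ^ J i / fact (J i)))
       = c k * exp_coeff c (l - k)"
proof -
  let ?w = "\<lambda>J. \<Prod>i\<in>supp J. c i ^ J i / fact (J i) :: complex"
  note iff = partitions_of_iff[of l l, simplified] partitions_of_iff[of "l - k" l, simplified]
  have kin: "k \<in> {1..l}" using assms by simp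
  have split: "(\<Sum>i\<in>{1..l}. i * J i) = k * J k + (\<Sum>i\<in>{1..l} - {k}. i * J i)" for J :: "nat \<Rightarrow> nat"
    using kin by (simp add: sum.remove)
  have raise: "supp (J(k := Suc (J k))) \<subseteq> {1..l} \<and> supp J \<subseteq> {1..l}
      \<and> (\<Sum>i\<in>{1..l}. i * (J(k := Suc (J k))) i) = l" if "J \<in> partitions_of (l - k)" for J
  proof -
    have J: "supp J \<subseteq> {1..l}" "(\<Sum>i\<in>{1..l}. i * J i) = l - k" using that by (auto simp: iff)
    moreover have "supp (J(k := Suc (J k))) \<subseteq> {1..l}" using J(1) kin by (auto simp: supp_def)
    moreover have "(\<Sum>i\<in>{1..l}. i * (J(k := Suc (J k))) i) = l"
      using J(2) assms unfolding split[of J] split[of "J(k := Suc (J k))"] by simp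
    ultimately show ?thesis by blast
  qed
  have "(\<Sum>J\<in>partitions_of (l - k). c k * ?w J) = (\<Sum>J\<in>partitions_of l. of_nat (J k) * ?w J)"
  proof (rule sum.reindex_bij_witness_not_neutral
      [where S' = "{}" and T' = "{J \<in> partitions_of l. J k = 0}"
         and j = "\<lambda>J. J(k := Suc (J k))" and i = "\<lambda>J. J(k := J k - 1)"])
    fix J assume "J \<in> partitions_of (l - k) - {}"
    then show "J(k := Suc (J k)) \<in> partitions_of l - {J \<in> partitions_of l. J k = 0}"
      using raise[of J] by (simp add: iff)
  next
    fix J assume "J \<in> partitions_of (l - k)"
    then have J: "supp (J(k := Suc (J k))) \<subseteq> {1..l}" "supp J \<subseteq> {1..l}"
      using raise by blast+
    have raised: "?w (J(k := Suc (J k)))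
        = c k ^ Suc (J k) / fact (Suc (J k)) * (\<Prod>i\<in>{1..l} - {k}. c i ^ J i / fact (J i))"
      unfolding prod_supp_extend[OF J(1)] using kin by (simp add: prod.remove)
    have orig: "?w J = c k ^ J k / fact (J k) * (\<Prod>i\<in>{1..l} - {k}. c i ^ J i / fact (J i))"
      unfolding prod_supp_extend[OF J(2)] using kin by (simp add: prod.remove)
    have factor: "of_nat (Suc (J k)) * (c k ^ Suc (J k) / fact (Suc (J k)))
        = c k * (c k ^ J k / fact (J k))"
      by (simp add: divide_simps del: of_nat_Suc)
    show "of_nat ((J(k := Suc (J k))) k) * ?w (J(k := Suc (J k))) = c k * ?w J"
      unfolding raised orig by (simp only: fun_upd_same mult.assoc[symmetric] factor)
  next
    fix J assume "J \<in> partitions_of l - {J \<in> partitions_of l. J k = 0}"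
    then have J: "supp J \<subseteq> {1..l}" "(\<Sum>i\<in>{1..l}. i * J i) = l" "J k \<noteq> 0" by (auto simp: iff)
    have *: "supp (J(k := J k - 1)) \<subseteq> {1..l}" using J(1) kin by (auto simp: supp_def)
    have "(\<Sum>i\<in>{1..l}. i * (J(k := J k - 1)) i) = l - k"
      using J(2,3) unfolding split[of J] split[of "J(k := J k - 1)"]
      by (cases "J k") simp_all
    then show "J(k := J k - 1) \<in> partitions_of (l - k) - {}"
      using * by (auto simp: iff)
    show "(J(k := J k - 1))(k := Suc ((J(k := J k - 1)) k)) = J"
      using J(3) by auto
  qed (auto simp: finite_partitions_of)
  then show ?thesis
    by (simp add: exp_coeff_def sum_distrib_left)
qed

text \<open>
  Write \<open>l = (\<Sum>k. k * J k)\<close> in every term and collect the terms belonging to each \<open>k\<close>. This is the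
  equation \<open>E' = C' * E\<close> satisfied by the exponential \<open>E\<close> of \<open>C = (\<Sum>k. c k * x\<^sup>k)\<close>, one coefficient
  at a time.
\<close>

lemma exp_coeff_recurrence:
  "of_nat l * exp_coeff c l = (\<Sum>k\<in>{1..l}. of_nat k * c k * exp_coeff c (l - k))"
proof -
  let ?w = "\<lambda>J. \<Prod>i\<in>supp J. c i ^ J i / fact (J i) :: complex"
  have "of_nat l * exp_coeff c l = (\<Sum>J\<in>partitions_of l. of_nat l * ?w J)"
    by (simp add: exp_coeff_def sum_distrib_left)
  also have "\<dots> = (\<Sum>J\<in>partitions_of l. \<Sum>k\<in>{1..l}. of_nat k * (of_nat (J k) * ?w J))"
  proof (rule sum.cong[OF refl])
    fix J assume "J \<in> partitions_of l"
    then have "(of_nat l :: complex) = of_nat (\<Sum>k\<in>{1..l}. k * J k)"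
      using partitions_of_iff[of l l J] by simp
    then show "of_nat l * ?w J = (\<Sum>k\<in>{1..l}. of_nat k * (of_nat (J k) * ?w J))"
      by (simp add: sum_distrib_right mult.assoc)
  qed
  also have "\<dots> = (\<Sum>k\<in>{1..l}. of_nat k * (\<Sum>J\<in>partitions_of l. of_nat (J k) * ?w J))"
    by (subst sum.swap) (simp add: sum_distrib_left)
  also have "\<dots> = (\<Sum>k\<in>{1..l}. of_nat k * c k * exp_coeff c (l - k))"
    by (intro sum.cong refl) (simp add: sum_partitions_multiplicity)
  finally show ?thesis .
qed

lemma partitions_of_0: "partitions_of 0 = {\<lambda>_. 0}"
proof (intro equalityI subsetI)
  fix J assume "J \<in> partitions_of 0"
  then have "supp J = {}" using partitions_of_iff[of 0 0 J] by simp
  then show "J \<in> {\<lambda>_. 0}" by (auto simp: supp_def)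
qed (simp add: partitions_of_def supp_def weight_def)

lemma exp_coeff_0: "exp_coeff c 0 = 1"
  by (simp add: exp_coeff_def partitions_of_0 supp_def)

text \<open>
  In characteristic \<open>0\<close> the equation \<open>A' = G * A\<close> determines each coefficient of \<open>A\<close> from the
  earlier ones.
\<close>

lemma fps_log_deriv_unique:
  fixes A B G :: "complex fps"
  assumes "fps_deriv A = G * A" "fps_deriv B = G * B" "fps_nth A 0 = fps_nth B 0"
  shows "A = B"
proof (rule fps_ext)
  fix l show "fps_nth A l = fps_nth B l"
  proof (induction l rule: less_induct)
    case (less l)
    show ?case
    proof (cases l)
      case (Suc l')
      have "fps_nth (G * A) l' = fps_nth (G * B) l'"
        unfolding fps_mult_nth using less Suc by (intro sum.cong refl) simp
      then have "of_nat (Suc l') * fps_nth A (Suc l') = of_nat (Suc l') * fps_nth B (Suc l')"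
        by (metis assms(1,2) fps_deriv_nth Suc_eq_plus1)
      then show ?thesis using Suc by (simp del: of_nat_Suc)
    qed (use assms(3) in simp)
  qed
qed

lemma exp_coeff_log_deriv:
  "fps_deriv (Abs_fps (exp_coeff c)) = fps_deriv (Abs_fps c) * Abs_fps (exp_coeff c)"
proof (rule fps_ext)
  fix l
  have "fps_nth (fps_deriv (Abs_fps (exp_coeff c))) l = of_nat (Suc l) * exp_coeff c (Suc l)"
    by simp
  also have "\<dots> = (\<Sum>k\<in>{1..Suc l}. of_nat k * c k * exp_coeff c (Suc l - k))"
    by (rule exp_coeff_recurrence)
  also have "\<dots> = (\<Sum>k\<in>{0..l}. of_nat (Suc k) * c (Suc k) * exp_coeff c (l - k))"
    by (rule sum.reindex_bij_witness[of _ Suc "\<lambda>k. k - 1"]) auto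
  also have "\<dots> = fps_nth (fps_deriv (Abs_fps c) * Abs_fps (exp_coeff c)) l"
    by (simp add: fps_mult_nth)
  finally show "fps_nth (fps_deriv (Abs_fps (exp_coeff c))) l
      = fps_nth (fps_deriv (Abs_fps c) * Abs_fps (exp_coeff c)) l" .
qed

text \<open>
  Convergence of the partition series comes from complex analysis: \<open>exp \<circ> G\<close> is
  holomorphic in the unit disc, hence the sum of its Taylor series there, and the Taylor series obeys
  the same differential equation as the series of \<open>exp_coeff c\<close>.
\<close>

lemma exp_power_series_sums:
  fixes G :: "complex \<Rightarrow> complex"
  assumes G: "\<And>z. norm z < 1 \<Longrightarrow> (\<lambda>k. c k * z ^ k) sums G z"
    and "c 0 = 0" and q: "norm q < 1"
  shows "(\<lambda>l. exp_coeff c l * q ^ l) sums exp (G q)"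
proof -
  define f where "f = (\<lambda>z. exp (G z))"
  have hol: "G holomorphic_on ball 0 1"
    using power_series_holomorphic[of 0 1 c G] G by simp
  have holf: "f holomorphic_on ball 0 1"
    unfolding f_def by (intro holomorphic_intros hol)
  define F where "F = fps_expansion f 0"
  have F: "f has_fps_expansion F"
    unfolding F_def by (rule has_fps_expansion_fps_expansion[OF _ _ holf]) auto
  have ev: "\<forall>\<^sub>F z in nhds 0. z \<in> ball (0::complex) 1"
    by (intro eventually_nhds_in_open) auto
  have GE: "G has_fps_expansion Abs_fps c"
    by (rule has_fps_expansionI, rule eventually_mono[OF ev]) (use G in auto)
  have "deriv f has_fps_expansion fps_deriv (Abs_fps c) * F"
  proof -
    have "(\<lambda>z. deriv G z * f z) has_fps_expansion fps_deriv (Abs_fps c) * F"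
      by (intro has_fps_expansion_mult has_fps_expansion_deriv GE F)
    moreover have "\<forall>\<^sub>F z in nhds 0. deriv G z * f z = deriv f z"
    proof (rule eventually_mono[OF ev])
      fix z :: complex assume "z \<in> ball 0 1"
      then have "(G has_field_derivative deriv G z) (at z)"
        using hol holomorphic_derivI open_ball by blast
      then have "(f has_field_derivative exp (G z) * deriv G z) (at z)"
        unfolding f_def by (auto intro!: derivative_eq_intros)
      then show "deriv G z * f z = deriv f z"
        by (simp add: DERIV_imp_deriv f_def)
    qed
    ultimately show ?thesis
      using has_fps_expansion_cong by fast
  qed
  then have "fps_deriv F = fps_deriv (Abs_fps c) * F"
    using fps_expansion_unique_complex has_fps_expansion_deriv[OF F] by blast
  moreover have "fps_nth F 0 = fps_nth (Abs_fps (exp_coeff c)) 0"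
  proof -
    have "G 0 = 0" using sums_unique[OF G[of 0]] \<open>c 0 = 0\<close> by (simp add: suminf_finite[of "{0}"])
    then show ?thesis by (simp add: F_def fps_expansion_def f_def exp_coeff_0)
  qed
  ultimately have FB: "F = Abs_fps (exp_coeff c)"
    using fps_log_deriv_unique exp_coeff_log_deriv by blast
  have "(\<lambda>l. (deriv ^^ l) f 0 / fact l * (q - 0) ^ l) sums f q"
    by (rule holomorphic_power_series[OF holf]) (use q in simp)
  then have "(\<lambda>l. fps_nth F l * q ^ l) sums f q"
    by (simp add: F_def fps_expansion_def)
  then show ?thesis by (simp add: FB f_def)
qed

section \<open>The logarithm of Euler's product\<close>

lemma norm_power_less_1:
  fixes x :: complex
  shows "norm x < 1 \<Longrightarrow> 0 < c \<Longrightarrow> norm (x ^ c) < 1"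
  by (simp add: norm_power power_less_one_iff)

text \<open>
  Expanding each logarithm turns \<open>- (\<Sum>d\<ge>1. Ln (1 - x\<^sup>d))\<close> into the double series
  \<open>\<Sum>d e. x^(d * e) / e\<close>. It converges absolutely, so it may be summed instead over the pairs
  with a fixed product \<open>k = d * e\<close>, where \<open>1 / e = d / k\<close> and the divisors \<open>d\<close> of \<open>k\<close> add up to
  \<open>sigma1 k / k\<close>. The two assertions share the witness \<open>s\<close> because they are the two ways of
  summing this one family.
\<close>

lemma log_double_series_sums:
  fixes x :: complex
  assumes x: "norm x < 1"
  defines "S \<equiv> (\<lambda>k. of_nat (sigma1 k) / of_nat k * x ^ k)"
  shows "\<exists>s. S sums s \<and> (\<lambda>a. Ln (1 - x ^ Suc a)) sums (- s)"
proof -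
  define r where "r = norm x"
  have r: "0 \<le> r" "r < 1" using x by (auto simp: r_def)
  define f :: "nat \<times> nat \<Rightarrow> complex" where
    "f = (\<lambda>(a, b). x ^ (Suc a * Suc b) / of_nat (Suc b))"
  have geo: "((\<lambda>n. r ^ n) has_sum (1 / (1 - r))) UNIV"
    using geometric_sums[of r] r by (intro norm_summable_imp_has_sum) (auto simp: summable_geometric)
  \<comment> \<open>Since \<open>(a + 1) * (b + 1) \<ge> a + b\<close> and \<open>r < 1\<close>, a product of two geometric series dominates.\<close>
  have "(\<lambda>(a, b). r ^ a * r ^ b) summable_on UNIV \<times> UNIV"
  proof (rule summable_on_SigmaI)
    fix a :: nat
    show "((\<lambda>b. case (a, b) of (a, b) \<Rightarrow> r ^ a * r ^ b) has_sum r ^ a * (1 / (1 - r))) UNIV"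
      using has_sum_cmult_right[OF geo] by simp
  next
    show "(\<lambda>a. r ^ a * (1 / (1 - r))) summable_on (UNIV :: nat set)"
      using has_sum_cmult_left[OF geo] summable_on_def by blast
  qed (use r in auto)
  then have norm_f: "(\<lambda>z. norm (f z)) summable_on UNIV \<times> UNIV"
  proof (rule summable_on_comparison_test)
    fix z :: "nat \<times> nat"
    obtain a b where z: "z = (a, b)" by (cases z)
    have "norm (f z) = r ^ (Suc a * Suc b) / real (Suc b)"
      by (simp add: z f_def norm_divide norm_power r_def
          del: of_nat_Suc mult_Suc power_Suc mult_Suc_right)
    also have "\<dots> \<le> r ^ (Suc a * Suc b)"
      using r divide_left_mono[of 1 "real (Suc b)" "r ^ (Suc a * Suc b)"]
      by (simp del: of_nat_Suc mult_Suc power_Suc mult_Suc_right)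
    also have "\<dots> \<le> r ^ (a + b)"
      using r by (intro power_decreasing) auto
    finally show "norm (f z) \<le> (case z of (a, b) \<Rightarrow> r ^ a * r ^ b)"
      by (simp add: z power_add)
  qed auto
  then have "f summable_on UNIV \<times> UNIV"
    by (rule abs_summable_summable)
  then obtain s where s: "(f has_sum s) (UNIV \<times> UNIV)"
    by (auto simp: summable_on_def)
  have rows: "((\<lambda>b. f (a, b)) has_sum - Ln (1 - x ^ Suc a)) UNIV" for a
  proof -
    have lt: "norm (x ^ Suc a) < 1"
      using norm_power_less_1[OF x] by blast
    have "(\<lambda>n. - ((x ^ Suc a) ^ n) / of_nat n) sums Ln (1 - x ^ Suc a)"
      using Ln_series'[of "- (x ^ Suc a)"] lt by simp
    from sums_minus[OF this] have "(\<lambda>n. (x ^ Suc a) ^ n / of_nat n) sums - Ln (1 - x ^ Suc a)"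
      by simp
    then have "(\<lambda>n. (x ^ Suc a) ^ Suc n / of_nat (Suc n)) sums - Ln (1 - x ^ Suc a)"
      by (subst sums_Suc_iff) simp
    then have *: "(\<lambda>b. f (a, b)) sums - Ln (1 - x ^ Suc a)"
      by (simp only: f_def prod.case power_mult)
    have "(\<lambda>b. norm (f (a, b))) summable_on UNIV"
      using norm_f unfolding Infinite_Sum.abs_summable_on_Sigma_iff by simp
    then have "summable (\<lambda>b. norm (f (a, b)))"
      by (rule summable_on_imp_summable)
    then show ?thesis using * by (rule norm_summable_imp_has_sum)
  qed
  have "((\<lambda>a. - Ln (1 - x ^ Suc a)) has_sum s) UNIV"
    by (rule has_sum_SigmaD[OF s rows])
  from sums_minus[OF has_sum_imp_sums[OF this]]
  have logs: "(\<lambda>a. Ln (1 - x ^ Suc a)) sums (- s)" by simp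
  define h :: "nat \<times> nat \<Rightarrow> complex" where "h = (\<lambda>(k, d). of_nat d / of_nat k * x ^ k)"
  have "(f has_sum s) (UNIV \<times> UNIV) = (h has_sum s) (Sigma {0<..} (\<lambda>k. {d. d dvd k}))"
  proof (rule has_sum_reindex_bij_witness
      [where j = "\<lambda>(a, b). (Suc a * Suc b, Suc a)" and i = "\<lambda>(k, d). (d - 1, k div d - 1)"])
    fix z :: "nat \<times> nat" assume "z \<in> UNIV \<times> UNIV"
    obtain a b where z: "z = (a, b)" by (cases z)
    show "(\<lambda>(k, d). (d - 1, k div d - 1)) ((\<lambda>(a, b). (Suc a * Suc b, Suc a)) z) = z"
      by (simp add: z del: mult_Suc mult_Suc_right)
    show "(\<lambda>(a, b). (Suc a * Suc b, Suc a)) z \<in> Sigma {0<..} (\<lambda>k. {d. d dvd k})"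
      by (simp add: z del: mult_Suc mult_Suc_right)
    show "h ((\<lambda>(a, b). (Suc a * Suc b, Suc a)) z) = f z"
      by (simp only: z h_def f_def prod.case of_nat_mult)
         (simp add: field_simps del: of_nat_Suc mult_Suc mult_Suc_right power_Suc)
  next
    fix z :: "nat \<times> nat" assume "z \<in> Sigma {0<..} (\<lambda>k. {d. d dvd k})"
    then obtain d e where "z = (d * e, d)" "0 < d" "0 < e"
      by (auto elim!: dvdE)
    then show "(\<lambda>(a, b). (Suc a * Suc b, Suc a)) ((\<lambda>(k, d). (d - 1, k div d - 1)) z) = z"
      by (simp del: mult_Suc mult_Suc_right)
  qed auto
  with s have h: "(h has_sum s) (Sigma {0<..} (\<lambda>k. {d. d dvd k}))" by simp
  have positive: "(S has_sum s) {0<..}"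
  proof (rule has_sum_SigmaD[OF h])
    fix k :: nat assume "k \<in> {0<..}"
    then have "finite {d. d dvd k}" by simp
    moreover have "(\<Sum>d | d dvd k. h (k, d)) = S k"
      by (simp add: S_def h_def sigma1_def sum_divide_distrib sum_distrib_right)
    ultimately show "((\<lambda>d. h (k, d)) has_sum S k) {d. d dvd k}"
      by (metis has_sum_finite)
  qed
  have "(S has_sum s) {0<..} = (S has_sum s) UNIV"
    by (rule has_sum_cong_neutral) (auto simp: S_def)
  with positive have "(S has_sum s) UNIV" by blast
  then show ?thesis using logs has_sum_imp_sums by blast
qed

lemma Q_eq_exp:
  assumes "norm (nome \<tau>) < 1"
    and "(\<lambda>k. of_nat (sigma1 k) / of_nat k * nome \<tau> ^ k) sums s"
  shows "Q \<tau> = exp (- s)"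
proof -
  let ?q = "nome \<tau>"
  have "(\<lambda>a. Ln (1 - ?q ^ Suc a)) sums (- s)"
    using log_double_series_sums[OF assms(1)] assms(2) sums_unique2 by metis
  then have "(\<lambda>a. exp (Ln (1 - ?q ^ Suc a))) has_prod exp (- s)"
    unfolding has_prod_def by (intro disjI1 sums_imp_has_prod_exp)
  moreover have "exp (Ln (1 - ?q ^ Suc a)) = 1 - ?q ^ Suc a" for a
  proof -
    have "norm (?q ^ Suc a) < 1"
      using norm_power_less_1[OF assms(1)] by blast
    then have "?q ^ Suc a \<noteq> 1" by auto
    then show ?thesis by (simp del: power_Suc)
  qed
  ultimately have "(\<lambda>a. 1 - ?q ^ Suc a) has_prod exp (- s)" by (simp only:)
  then show ?thesis unfolding Q_def by (metis has_prod_unique)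
qed

section \<open>The arithmetic of divisor sums\<close>

lemma sigma1_over_of_nat_div:
  assumes "0 < c"
  shows "sigma1_over (real k / real c)
       = (if c dvd k then real (sigma1 (k div c)) / real (k div c) else 0)"
proof (cases "c dvd k")
  case True
  then obtain e where "k = c * e" by (elim dvdE)
  then show ?thesis using assms by (auto simp: sigma1_over_def)
next
  case False
  have "real k / real c \<notin> \<nat>"
  proof
    assume "real k / real c \<in> \<nat>"
    then obtain e where "real k / real c = real e" by (auto elim: Nats_cases)
    then have "real k = real (e * c)" using assms by (simp add: field_simps)
    then show False using False by (metis dvd_triv_right of_nat_eq_iff)
  qed
  then show ?thesis using False by (simp add: sigma1_over_def)
qed

text \<open>
  An even divisor of \<open>2 * j\<close> is twice a divisor of \<open>j\<close>, and an odd one divides \<open>j\<close> itself.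
\<close>

lemma sigma1_double:
  assumes "0 < j"
  shows "sigma1 (2 * j) = (\<Sum>{d. d dvd j \<and> odd d}) + 2 * sigma1 j"
proof -
  have "{d. d dvd 2 * j} = {d. d dvd j \<and> odd d} \<union> (*) 2 ` {d. d dvd j}"
  proof (intro equalityI subsetI)
    fix d assume "d \<in> {d. d dvd 2 * j}"
    then show "d \<in> {d. d dvd j \<and> odd d} \<union> (*) 2 ` {d. d dvd j}"
      by (cases "even d") (auto simp: coprime_dvd_mult_right_iff elim!: evenE)
  qed auto
  moreover have "finite {d. d dvd j}" using assms by simp
  ultimately show ?thesis
    unfolding sigma1_def
    by (subst \<open>{d. d dvd 2 * j} = _\<close>, subst sum.union_disjoint)
       (auto simp: sum.reindex inj_on_def sum_distrib_left)
qed

lemma sigma1_odd: "odd j \<Longrightarrow> sigma1 j = \<Sum>{d. d dvd j \<and> odd d}"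
  unfolding sigma1_def by (intro sum.cong) auto

text \<open>
  All three terms vanish unless \<open>c\<close> divides \<open>k\<close> and \<open>k > 0\<close>. Then \<open>k = 2 * c * j\<close> with
  \<open>j > 0\<close>, and the claim is \<open>\<sigma>(2 * j) - 3 * \<sigma>(j) + 2 * \<sigma>(j / 2) = 0\<close>, where \<open>\<sigma>(j / 2) = 0\<close>
  for odd \<open>j\<close>. Both \<open>\<sigma>(2 * j) - 2 * \<sigma>(j)\<close> and \<open>\<sigma>(j) - 2 * \<sigma>(j / 2)\<close> equal the sum of the odd
  divisors of \<open>j\<close>. This makes the coefficient of an even power of the nome independent of \<open>h\<close>,
  whence the asymmetric pair of arguments \<open>i + 2 * h\<close> and \<open>i\<close> in the theorem.
\<close>

lemma sigma1_even_relation: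
  assumes "odd c" "even k"
  shows "2 * sigma1_over (real k / real c) - 3 * sigma1_over (real k / real (2 * c))
       + sigma1_over (real k / real (4 * c)) = 0"
proof (cases "c dvd k \<and> k \<noteq> 0")
  case False
  have c: "0 < c" using assms(1) by (rule odd_pos)
  have "\<not> 2 * c dvd k" "\<not> 4 * c dvd k" if "\<not> c dvd k"
    using that dvd_mult_right by blast+
  then show ?thesis using False c
    by (subst (1 2 3) sigma1_over_of_nat_div) (auto simp: sigma1_def)
next
  case True
  have c: "0 < c" using assms(1) by (rule odd_pos)
  from True obtain y where "k = c * y" by (auto elim: dvdE)
  with True assms c obtain j where k: "k = c * (2 * j)" and j: "0 < j"
    by (auto elim!: evenE)
  have s2: "sigma1_over (real k / real (2 * c)) = real (sigma1 j) / real j"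
    using c j by (subst sigma1_over_of_nat_div) (auto simp: k)
  have s1: "sigma1_over (real k / real c) = real (sigma1 (2 * j)) / real (2 * j)"
    using c j by (subst sigma1_over_of_nat_div) (auto simp: k)
  show ?thesis
  proof (cases "even j")
    case False
    have "\<not> 4 * c dvd c * (2 * j)"
    proof
      assume "4 * c dvd c * (2 * j)"
      then have "(2 * c) * 2 dvd (2 * c) * j" by (simp add: mult_ac)
      then have "2 dvd j" using c by simp
      then show False using False by simp
    qed
    then have "sigma1_over (real k / real (4 * c)) = 0"
      using c by (subst sigma1_over_of_nat_div) (auto simp: k)
    then show ?thesis
      unfolding s1 s2 using sigma1_double[OF j] sigma1_odd[OF False] j by (simp add: field_simps)
  next
    case True
    then obtain i where i: "j = 2 * i" by (elim evenE)
    have k4: "k = 4 * c * i" by (simp add: k i)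
    have s4: "sigma1_over (real k / real (4 * c)) = real (sigma1 i) / real i"
      using c j by (subst sigma1_over_of_nat_div) (auto simp: k4)
    have "{d. d dvd 2 * i \<and> odd d} = {d. d dvd i \<and> odd d}"
      by (auto simp: coprime_dvd_mult_right_iff)
    then have "real (sigma1 (2 * j)) = 3 * real (sigma1 j) - 2 * real (sigma1 i)"
      using sigma1_double[of j] sigma1_double[of i] j i by simp
    then show ?thesis
      unfolding s1 s2 s4 using i j by (simp add: field_simps)
  qed
qed

section \<open>The logarithm of the eta quotients\<close>

definition log_euler :: "complex \<Rightarrow> complex" where
  "log_euler x = (\<Sum>k. of_nat (sigma1 k) / of_nat k * x ^ k)"

lemma log_euler_sums:
  assumes "norm x < 1"
  shows "(\<lambda>k. of_nat (sigma1 k) / of_nat k * x ^ k) sums log_euler x"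
  unfolding log_euler_def using log_double_series_sums[OF assms] sums_summable summable_sums by blast

text \<open>
  Because \<open>sigma1_over\<close> vanishes off the integers, the series in powers of \<open>x\<^sup>c\<close> can be written as
  a series over all powers of \<open>x\<close>, and series for different \<open>c\<close> can be combined term by term.
\<close>

lemma log_euler_power_sums:
  assumes "norm x < 1" "0 < c"
  shows "(\<lambda>k. of_real (sigma1_over (real k / real c)) * x ^ k) sums log_euler (x ^ c)"
proof -
  have "norm (x ^ c) < 1"
    using assms by (rule norm_power_less_1)
  from log_euler_sums[OF this]
  have "(\<lambda>e. of_real (sigma1_over (real (c * e) / real c)) * x ^ (c * e)) sums log_euler (x ^ c)"
    using assms(2) by (subst sigma1_over_of_nat_div) (auto simp: power_mult)
  then show ?thesis
    using assms(2)
    by (subst (asm) sums_mono_reindex[where g = "\<lambda>e. c * e"])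
       (auto simp: strict_mono_def sigma1_over_of_nat_div elim!: dvdE)
qed

lemma nome_of_nat_mult: "nome (of_nat c * \<tau>) = nome \<tau> ^ c"
  by (simp add: nome_def exp_of_nat_mult[symmetric] mult_ac)

lemma norm_nome_less_1: "0 < Im \<tau> \<Longrightarrow> norm (nome \<tau>) < 1"
  by (simp add: nome_def)

lemma Q_of_nat_mult_eq_exp:
  assumes "norm (nome \<tau>) < 1" "0 < c"
  shows "Q (of_nat c * \<tau>) = exp (- log_euler (nome \<tau> ^ c))"
proof -
  have "norm (nome (of_nat c * \<tau>)) < 1"
    unfolding nome_of_nat_mult using assms by (rule norm_power_less_1)
  then show ?thesis
    using Q_eq_exp log_euler_sums by (metis nome_of_nat_mult)
qed

text \<open>
  Minus \<open>1/n\<close> times the logarithm of that part of \<open>X\<^sup>i * Y\<^sup>h\<close> that comes from one of the two points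
  \<open>\<tau>\<close> and \<open>p * \<tau>\<close>, without the factor \<open>2 ^ n * q ^ m\<close> of \<open>X\<close>; here \<open>x\<close> is the nome of that point.
\<close>

definition eta_quotient_log :: "nat \<Rightarrow> nat \<Rightarrow> complex \<Rightarrow> complex" where
  "eta_quotient_log i h x = (of_nat i + 2 * of_nat h) * log_euler x
     - 3 * (of_nat i + of_nat h) * log_euler (x ^ 2) + (2 * of_nat i + of_nat h) * log_euler (x ^ 4)"

lemma eta_quotient_eq_exp:
  fixes L1 L2 L4 :: complex
  assumes "A1 = exp (- L1)" "A2 = exp (- L2)" "A4 = exp (- L4)"
  shows "(A1 ^ n * A4 ^ (2 * n) / A2 ^ (3 * n)) ^ i * (A1 ^ (2 * n) * A4 ^ n / A2 ^ (3 * n)) ^ h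
     = exp (- of_nat n * ((of_nat i + 2 * of_nat h) * L1 - 3 * (of_nat i + of_nat h) * L2
          + (2 * of_nat i + of_nat h) * L4))"
  unfolding assms exp_of_nat_mult[symmetric] exp_add[symmetric] exp_diff[symmetric]
  by (intro arg_cong[where f = exp]) (simp add: algebra_simps)

text \<open>
  The coefficient of \<open>x\<^sup>k\<close> is \<open>i * (s 1 - 3 * s 2 + 2 * s 4) + h * (2 * s 1 - 3 * s 2 + s 4)\<close>,
  where \<open>s e\<close> stands for \<open>sigma1_over (k / (e * c))\<close>. For odd \<open>k\<close> only \<open>s 1\<close> is nonzero, and for
  even \<open>k\<close> the factor of \<open>h\<close> vanishes by \<open>sigma1_even_relation\<close>. As \<open>c\<close> is odd, \<open>k / c\<close> has the
  parity of \<open>k\<close> whenever it is an integer, so a single case distinction serves both \<open>c = 1\<close> and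
  \<open>c = p\<close>.
\<close>

lemma eta_quotient_log_sums:
  assumes "norm x < 1" "odd c"
  shows "(\<lambda>k. of_real ((if odd k then real i + 2 * real h else real i)
            * (sigma1_over (real k / real c) - 3 * sigma1_over (real k / real (2 * c))
               + 2 * sigma1_over (real k / real (4 * c)))) * x ^ k) sums eta_quotient_log i h (x ^ c)"
proof -
  have c: "0 < c" using assms(2) by (rule odd_pos)
  let ?s = "\<lambda>c k. sigma1_over (real k / real c)"
  have "(\<lambda>k. (of_nat i + 2 * of_nat h) * (of_real (?s c k) * x ^ k)
           - 3 * (of_nat i + of_nat h) * (of_real (?s (2 * c) k) * x ^ k)
           + (2 * of_nat i + of_nat h) * (of_real (?s (4 * c) k) * x ^ k)) sums
        ((of_nat i + 2 * of_nat h) * log_euler (x ^ c)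
           - 3 * (of_nat i + of_nat h) * log_euler (x ^ (2 * c))
           + (2 * of_nat i + of_nat h) * log_euler (x ^ (4 * c)))"
    by (intro sums_add sums_diff sums_mult log_euler_power_sums assms(1)) (use c in auto)
  moreover have "(of_nat i + 2 * of_nat h) * (of_real (?s c k) * x ^ k)
           - 3 * (of_nat i + of_nat h) * (of_real (?s (2 * c) k) * x ^ k)
           + (2 * of_nat i + of_nat h) * (of_real (?s (4 * c) k) * x ^ k)
      = of_real ((if odd k then real i + 2 * real h else real i)
            * (?s c k - 3 * ?s (2 * c) k + 2 * ?s (4 * c) k)) * x ^ k" for k
  proof -
    have "(real i + 2 * real h) * ?s c k - 3 * (real i + real h) * ?s (2 * c) k
           + (2 * real i + real h) * ?s (4 * c) k
        = (if odd k then real i + 2 * real h else real i)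
            * (?s c k - 3 * ?s (2 * c) k + 2 * ?s (4 * c) k)"
    proof (cases "odd k")
      case True
      then have "\<not> 2 * c dvd k" "\<not> 4 * c dvd k"
        by (metis dvd_mult_left even_numeral dvd_trans)+
      then have "?s (2 * c) k = 0" "?s (4 * c) k = 0"
        using c by (subst sigma1_over_of_nat_div; simp)+
      then show ?thesis using True by simp
    next
      case False
      then have "2 * ?s c k - 3 * ?s (2 * c) k + ?s (4 * c) k = 0"
        using sigma1_even_relation[OF assms(2)] by simp
      then have "real h * (2 * ?s c k - 3 * ?s (2 * c) k + ?s (4 * c) k) = 0" by simp
      then show ?thesis using False by (simp add: algebra_simps)
    qed
    from arg_cong[OF this, of "\<lambda>y. complex_of_real y * x ^ k"]
    show ?thesis by (simp add: algebra_simps)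
  qed
  ultimately show ?thesis
    by (simp add: eta_quotient_log_def power_mult mult.commute[of _ c])
qed

section \<open>The partition coefficients as exponential coefficients\<close>

definition b_exponent :: "nat \<Rightarrow> nat \<Rightarrow> real \<Rightarrow> real \<Rightarrow> nat \<Rightarrow> complex" where
  "b_exponent p n u v k = of_real (- real n * (if odd k then u else v) * alpha p k)"

lemma b_exponent_sums:
  assumes "odd p" "norm x < 1"
  shows "(\<lambda>k. b_exponent p n (real i + 2 * real h) (real i) k * x ^ k) sums
           (- of_nat n * (eta_quotient_log i h x + eta_quotient_log i h (x ^ p)))"
proof -
  have "(\<lambda>k. - of_nat n * (of_real ((if odd k then real i + 2 * real h else real i)
            * (sigma1_over (real k / real 1) - 3 * sigma1_over (real k / real (2 * 1))
               + 2 * sigma1_over (real k / real (4 * 1)))) * x ^ k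
          + of_real ((if odd k then real i + 2 * real h else real i)
            * (sigma1_over (real k / real p) - 3 * sigma1_over (real k / real (2 * p))
               + 2 * sigma1_over (real k / real (4 * p)))) * x ^ k)) sums
          (- of_nat n * (eta_quotient_log i h (x ^ 1) + eta_quotient_log i h (x ^ p)))"
    by (intro sums_mult sums_add eta_quotient_log_sums assms) auto
  also have "(\<lambda>k. - of_nat n * (of_real ((if odd k then real i + 2 * real h else real i)
            * (sigma1_over (real k / real 1) - 3 * sigma1_over (real k / real (2 * 1))
               + 2 * sigma1_over (real k / real (4 * 1)))) * x ^ k
          + of_real ((if odd k then real i + 2 * real h else real i)
            * (sigma1_over (real k / real p) - 3 * sigma1_over (real k / real (2 * p))
               + 2 * sigma1_over (real k / real (4 * p)))) * x ^ k))
       = (\<lambda>k. b_exponent p n (real i + 2 * real h) (real i) k * x ^ k)"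
    by (rule ext) (simp add: b_exponent_def alpha_def algebra_simps)
  finally show ?thesis by simp
qed

text \<open>
  Each of the factors \<open>(- n) ^ size_part J\<close>, \<open>u ^ odd_part J\<close>, \<open>v ^ even_part J\<close> is itself a
  product over the support of \<open>J\<close>, so the whole summand of \<open>b\<close> is one.
\<close>

lemma b_eq_exp_coeff: "of_real (b p n l u v) = exp_coeff (b_exponent p n u v) l"
proof (cases "l = 0")
  case True
  then show ?thesis by (simp add: b_def exp_coeff_0)
next
  case False
  have "(- real n) ^ size_part J * u ^ odd_part J * v ^ even_part J * Wp p J
      = (\<Prod>k\<in>supp J. (- real n * (if odd k then u else v) * alpha p k) ^ J k / fact (J k))"
    if "J \<in> partitions_of l" for J
  proof -
    have fin: "finite (supp J)" using that by (simp add: partitions_of_def)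
    have odd: "u ^ odd_part J = (\<Prod>k\<in>supp J. if odd k then u ^ J k else 1)"
      unfolding odd_part_def power_sum using fin by (rule prod.inter_filter)
    have even: "v ^ even_part J = (\<Prod>k\<in>supp J. if even k then v ^ J k else 1)"
      unfolding even_part_def power_sum using fin by (rule prod.inter_filter)
    show ?thesis
      unfolding odd even size_part_def power_sum Wp_def prod.distrib[symmetric]
      by (intro prod.cong refl) (auto simp flip: power_mult_distrib)
  qed
  then show ?thesis using False
    by (simp add: b_def exp_coeff_def b_exponent_def)
qed

theorem lemma2p1:
  fixes p m n i h :: nat and \<tau> :: complex
  assumes "prime p" and "odd p"
    and "m > 0" and "n > 0" and "coprime m n"
    and "(real p + 1) / 8 = real m / real n"
    and "Im \<tau> > 0"
  shows "summable (\<lambda>l. of_real (b p n l (real i + 2 * real h) (real i)) * nome \<tau> ^ l)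
       \<and> XX p m n \<tau> ^ i * YY p n \<tau> ^ h =
           2 ^ (n * i) * nome \<tau> ^ (m * i)
           * (\<Sum>l. of_real (b p n l (real i + 2 * real h) (real i)) * nome \<tau> ^ l)"
proof -
  let ?q = "nome \<tau>"
  let ?S = "- of_nat n * (eta_quotient_log i h ?q + eta_quotient_log i h (?q ^ p))"
  have q: "norm ?q < 1" using assms(7) by (rule norm_nome_less_1)
  have p: "0 < p" using assms(2) by (rule odd_pos)
  have "b_exponent p n (real i + 2 * real h) (real i) 0 = 0"
    by (simp add: b_exponent_def alpha_def sigma1_over_def)
  then have series: "(\<lambda>l. of_real (b p n l (real i + 2 * real h) (real i)) * ?q ^ l) sums exp ?S"
    unfolding b_eq_exp_coeff by (intro exp_power_series_sums b_exponent_sums assms(2) q)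
  define U where "U c = Q (of_nat c * \<tau>) ^ n * Q (4 * of_nat c * \<tau>) ^ (2 * n)
      / Q (2 * of_nat c * \<tau>) ^ (3 * n)" for c
  define V where "V c = Q (of_nat c * \<tau>) ^ (2 * n) * Q (4 * of_nat c * \<tau>) ^ n
      / Q (2 * of_nat c * \<tau>) ^ (3 * n)" for c
  have eta_quotient: "U c ^ i * V c ^ h = exp (- of_nat n * eta_quotient_log i h (?q ^ c))"
    if "0 < c" for c
  proof -
    have "?q ^ (2 * c) = (?q ^ c) ^ 2" "?q ^ (4 * c) = (?q ^ c) ^ 4"
      by (simp_all only: mult.commute[of _ c] power_mult)
    then have "Q (of_nat c * \<tau>) = exp (- log_euler (?q ^ c))"
      "Q (2 * of_nat c * \<tau>) = exp (- log_euler ((?q ^ c) ^ 2))"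
      "Q (4 * of_nat c * \<tau>) = exp (- log_euler ((?q ^ c) ^ 4))"
      using Q_of_nat_mult_eq_exp[OF q, of c] Q_of_nat_mult_eq_exp[OF q, of "2 * c"]
        Q_of_nat_mult_eq_exp[OF q, of "4 * c"] that by simp_all
    then show ?thesis unfolding eta_quotient_log_def U_def V_def by (rule eta_quotient_eq_exp)
  qed
  have "XX p m n \<tau> ^ i * YY p n \<tau> ^ h
      = (2 ^ n * ?q ^ m * U 1 * U p) ^ i * (V 1 * V p) ^ h"
    by (simp add: XX_def YY_def U_def V_def)
  also have "\<dots> = 2 ^ (n * i) * ?q ^ (m * i) * ((U 1 ^ i * V 1 ^ h) * (U p ^ i * V p ^ h))"
    by (simp only: power_mult_distrib power_mult[symmetric] mult_ac)
  also have "(U 1 ^ i * V 1 ^ h) * (U p ^ i * V p ^ h) = exp ?S"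
    using p by (simp only: eta_quotient exp_add[symmetric] power_one_right distrib_left zero_less_one)
  finally have "XX p m n \<tau> ^ i * YY p n \<tau> ^ h = 2 ^ (n * i) * ?q ^ (m * i) * exp ?S" .
  then show ?thesis
    using series by (auto simp: sums_iff)
qed

end
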